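(* Let $n,k,d$ be positive integers with $2 \le d \le k \le n/2$. Suppose $\mathcal{F}^* \subseteq \mathcal{F} \subseteq \binom{[n]}{k}$ have the property that every $d$-cluster contained in $\mathcal{F}$ is contained entirely in $\mathcal{F}^*$. Then $$|\mathcal{F}^*| + \frac{n}{k}\,|\mathcal{F} \setminus \mathcal{F}^*| \le \binom{n}{k}.$$ Furthermore, except in the case where both $d=2$ and $n=2k$, equality implies one of the following: (1) $\mathcal{F}^* = \emptyset$ and $\mathcal{F}$ is a star of maximum size, i.e. $\mathcal{F} = \{B \in \binom{[n]}{k} : x \in B\}$ for some $x \in [n]$; or (2) $\mathcal{F} = \mathcal{F}^* = \binom{[n]}{k}$.
   Context: $[n] = \{1,\dots,n\}$ and $\binom{X}{k}$ denotes the set of $k$-element subsets of $X$. A $d$-cluster is a collection $\{B_1,\dots,B_d\}$ of $d$ distinct elements of $\binom{[n]}{k}$ such that $|B_1 \cup \dots \cup B_d| \le 2k$ and $B_1 \cap \dots \cap B_d = \emptyset$. A family is a star centered at $x$ if all its members contain $x$; the maximum size of a star is $\binom{n-1}{k-1}$. *)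

theory Defs
  imports Complex_Main "HOL-Library.Ramsey"
begin

(* nsets A k, written [A]\<^bsup>k\<^esup>, is the family of k-element subsets of A.
   A cluster is a set of sets, so card C = d says that B_1, ..., B_d are distinct.
   For d > 0 it also makes C finite and nonempty, so \<Inter>C is a genuine intersection. *)

definition is_cluster :: "nat \<Rightarrow> nat \<Rightarrow> nat \<Rightarrow> nat set set \<Rightarrow> bool" where
  "is_cluster n k d C \<longleftrightarrow>
     C \<subseteq> nsets {1..n} k \<and> card C = d \<and> card (\<Union>C) \<le> 2 * k \<and> \<Inter>C = {}"

definition max_star :: "nat \<Rightarrow> nat \<Rightarrow> nat \<Rightarrow> nat set set" where
  "max_star n k x = {B \<in> nsets {1..n} k. x \<in> B}"

end

theory Submission
  imports Defs "HOL-Combinatorics.Multiset_Permutations"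
begin

text \<open>
  The proof is an induction on \<open>d\<close>. For \<open>d = 2\<close> the members of \<open>F - Fs\<close> meet every member of
  \<open>F\<close>, and Katona's cycle method applies: if an arc of a cyclic order lies in \<open>F - Fs\<close>, the arcs
  meeting it split into \<open>k - 1\<close> disjoint pairs, each of weight at most \<open>n / k\<close>.

  For \<open>d + 1\<close> pass to the links of the points \<open>x\<close>, where the special subfamily consists of the link of
  \<open>Fs\<close> together with all \<open>d\<close>-clusters of the link of \<open>F\<close>. If \<open>B \<in> F - Fs\<close> and \<open>B - {x}\<close> is in such a
  cluster, then no \<open>B - {x} \<union> {y}\<close> with \<open>y \<notin> B\<close> is in \<open>F\<close>, because adding it would complete a
  \<open>(d + 1)\<close>-cluster containing \<open>B\<close>. Let \<open>M\<close> be the number of such pairs \<open>(B, x)\<close>. Counting the excluded sets gives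
  \<open>k |F| + (n - k) M \<le> k (n choose k)\<close>, and summing the induction hypothesis over all links gives
  \<open>k |Fs| + M + (n - 1) / (k - 1) (k |F - Fs| - M) \<le> k (n choose k)\<close>. A suitable combination of the two
  eliminates \<open>M\<close> and is the claim.
\<close>

section \<open>Counting \<open>k\<close>-element subsets\<close>

lemma card_nsets:
  assumes "finite A"
  shows "card (nsets A k) = card A choose k"
proof -
  have "nsets A k = {B. B \<subseteq> A \<and> card B = k}"
    using assms by (auto simp: nsets_def intro: finite_subset)
  then show ?thesis using n_subsets[OF assms] by simp
qed

lemma bij_betw_insert_nsets:
  assumes "x \<in> V" "0 < k"
  shows "bij_betw (insert x) (nsets (V - {x}) (k - 1)) {B \<in> nsets V k. x \<in> B}"
proof (rule bij_betwI[where g = "\<lambda>B. B - {x}"])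
  show "insert x \<in> nsets (V - {x}) (k - 1) \<rightarrow> {B \<in> nsets V k. x \<in> B}"
    using assms by (auto simp: nsets_def card_insert_if)
qed (auto simp: nsets_def)

section \<open>Arcs of a cyclic order\<close>

text \<open>Positions are integers read modulo the length, so arcs can be shifted either way with no
  case split at the seam of the list.\<close>

definition cyc :: "'a list \<Rightarrow> int \<Rightarrow> 'a" where
  "cyc xs i = xs ! nat (i mod int (length xs))"

definition arc :: "'a list \<Rightarrow> nat \<Rightarrow> int \<Rightarrow> 'a set" where
  "arc xs k i = cyc xs ` {i..<i + int k}"

lemma arc_add_length: "arc xs k (i + int (length xs)) = arc xs k i"
proof -
  have "{i + int (length xs)..<i + int (length xs) + int k} = (\<lambda>j. j + int (length xs)) ` {i..<i + int k}"
    by (auto simp: image_iff intro!: bexI[of _ "_ - int (length xs)"])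
  then show ?thesis
    by (simp only: arc_def image_image) (simp add: cyc_def)
qed

lemma inj_on_cyc:
  assumes "distinct xs" "xs \<noteq> []"
  shows "inj_on (cyc xs) {a..<a + int (length xs)}"
proof (rule inj_onI)
  fix i j assume ij: "i \<in> {a..<a + int (length xs)}" "j \<in> {a..<a + int (length xs)}"
    and eq: "cyc xs i = cyc xs j"
  let ?n = "int (length xs)"
  have n: "?n > 0" using assms by simp
  then have "nat (i mod ?n) = nat (j mod ?n)"
    using eq assms by (simp add: cyc_def nth_eq_iff_index_eq nat_less_iff)
  then have "i mod ?n = j mod ?n"
    using n by (simp add: eq_nat_nat_iff)
  then have "?n dvd i - j" by (simp add: mod_eq_dvd_iff)
  moreover have "\<bar>i - j\<bar> < ?n" using ij by auto
  ultimately show "i = j"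
    using dvd_imp_le_int[of "i - j" ?n] by fastforce
qed

text \<open>The last hypothesis places both windows inside one period, where \<open>cyc\<close> is
  injective, so the arcs meet exactly as their index intervals do.\<close>

lemma arc_Int:
  assumes "distinct xs" "xs \<noteq> []" "i \<le> j" "j + int k \<le> i + int (length xs)"
  shows "arc xs k i \<inter> arc xs k j = cyc xs ` {j..<i + int k}"
proof -
  have "cyc xs ` {i..<i + int k} \<inter> cyc xs ` {j..<j + int k}
      = cyc xs ` ({i..<i + int k} \<inter> {j..<j + int k})"
    using inj_on_cyc[OF assms(1,2), of i] assms(3,4)
    by (subst inj_on_image_Int[where C = "{i..<i + int (length xs)}"]) auto
  also have "{i..<i + int k} \<inter> {j..<j + int k} = {j..<i + int k}"
    using assms by auto
  finally show ?thesis by (simp add: arc_def)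
qed

lemma arc_disjoint:
  assumes "distinct xs" "xs \<noteq> []" "i + int k \<le> j" "j + int k \<le> i + int (length xs)"
  shows "arc xs k i \<inter> arc xs k j = {}"
  using arc_Int[OF assms(1,2), of i j k] assms by simp

lemma arc_of_nat:
  assumes "xs \<noteq> []" "k \<le> length xs"
  shows "arc xs k (int i) = set (take k (rotate i xs))"
proof -
  have "{int i..<int i + int k} = (\<lambda>j. int (i + j)) ` {..<k}"
    by (auto simp: image_iff intro!: bexI[of _ "nat (_ - int i)"])
  then have "arc xs k (int i) = (\<lambda>j. cyc xs (int (i + j))) ` {..<k}"
    unfolding arc_def by (simp only: image_image)
  also have "\<dots> = (\<lambda>j. rotate i xs ! j) ` {..<k}"
    using assms by (intro image_cong) (auto simp: cyc_def nth_rotate simp flip: of_nat_mod of_nat_add)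
  also have "\<dots> = set (take k (rotate i xs))"
    using assms nth_image[of k "rotate i xs"] by (simp add: atLeast0LessThan)
  finally show ?thesis .
qed

text \<open>Lets prescribed sets appear as arcs: an ordering is built by concatenating blocks, and
  consecutive blocks of total length \<open>k\<close> form an arc.\<close>

lemma arc_append:
  assumes "xs = us @ ys @ vs" "length ys = k" "0 < k"
  shows "arc xs k (int (length us)) = set ys"
  using assms by (subst arc_of_nat) (auto simp: rotate_append)

text \<open>Moving the window one step trades \<open>f a\<close> for the equal value
  \<open>f (a + int n)\<close>.\<close>

lemma sum_int_periodic:
  fixes f :: "int \<Rightarrow> 'b::ab_group_add"
  assumes "\<And>i. f (i + int n) = f i"
  shows "sum f {a..<a + int n} = sum f {b..<b + int n}"
proof (cases "n = 0")
  case False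
  have step: "sum f {a + 1..<a + 1 + int n} = sum f {a..<a + int n}" for a
  proof -
    have "{a..<a + int n} = insert a {a + 1..<a + int n}"
      "{a + 1..<a + 1 + int n} = insert (a + int n) {a + 1..<a + int n}"
      using False by auto
    then show ?thesis using assms by simp
  qed
  have "sum f {a..<a + int n} = sum f {0..<0 + int n}" for a
  proof (induction a rule: int_induct[of _ 0])
    case (step2 i)
    then show ?case using step[of "i - 1"] by simp
  qed (use step in simp_all)
  then show ?thesis by metis
qed simp

text \<open>Besides \<open>a\<close>, only the \<open>k - 1\<close> starts on either side of it
  contribute. A start \<open>i\<close> after \<open>a\<close> is matched with the start
  \<open>i - int k\<close> before \<open>a\<close>: the two windows are adjacent, so in a distinct
  list the arcs are disjoint.\<close>

lemma sum_arc_unfold: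
  fixes f :: "'a set \<Rightarrow> real"
  assumes n: "length xs = n" and k: "0 < k" "2 * k \<le> n"
    and far: "\<And>i. a + int k \<le> i \<Longrightarrow> i \<le> a + int n - int k \<Longrightarrow> f (arc xs k i) = 0"
  shows "(\<Sum>i = 0..<int n. f (arc xs k i))
    = f (arc xs k a) + (\<Sum>i = a + 1..<a + int k. f (arc xs k i) + f (arc xs k (i - int k)))"
proof -
  let ?g = "\<lambda>i. f (arc xs k i)"
  have per: "?g (i + int n) = ?g i" for i
    using arc_add_length[of xs k i] n by simp
  let ?M = "{a + int k..a + int n - int k}" and ?I = "{a + 1..<a + int k}"
    and ?J = "{a + int n - int k + 1..<a + int n}"
  have "(\<Sum>i = 0..<int n. ?g i) = sum ?g {a..<a + int n}"
    using sum_int_periodic[of ?g n, OF per, of 0 a] by simp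
  also have "{a..<a + int n} = insert a (?I \<union> ?M \<union> ?J)"
    using k by auto
  also have "sum ?g \<dots> = ?g a + (sum ?g ?I + sum ?g ?M + sum ?g ?J)"
    using k by (subst sum.insert, simp, simp, subst sum.union_disjoint, simp, simp, force,
        subst sum.union_disjoint) auto
  also have "sum ?g ?M = 0" using far by (intro sum.neutral) auto
  also have "sum ?g ?J = (\<Sum>i\<in>?I. ?g (i - int k))"
  proof (rule sum.reindex_bij_witness[of _ "\<lambda>i. i + int n - int k" "\<lambda>i. i - int n + int k"])
    fix i show "?g (i - int n + int k - int k) = ?g i"
      using per[of "i - int n"] by simp
  qed auto
  finally show ?thesis by (simp add: sum.distrib add.assoc)
qed

section \<open>Double counting over all orderings of the ground set\<close>

lemma card_permutations_prefix:
  assumes "finite V" "B \<in> nsets V k"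
  shows "card {xs \<in> permutations_of_set V. set (take k xs) = B} = fact k * fact (card V - k)"
proof -
  have B: "B \<subseteq> V" "finite B" "card B = k" using assms by (auto simp: nsets_def)
  have "bij_betw (\<lambda>(ys, zs). ys @ zs) (permutations_of_set B \<times> permutations_of_set (V - B))
      {xs \<in> permutations_of_set V. set (take k xs) = B}"
  proof (rule bij_betwI[where g = "\<lambda>xs. (take k xs, drop k xs)"])
    show "(\<lambda>(ys, zs). ys @ zs) \<in> permutations_of_set B \<times> permutations_of_set (V - B)
      \<rightarrow> {xs \<in> permutations_of_set V. set (take k xs) = B}"
      using B length_finite_permutations_of_set[of _ B]
      by (auto simp: permutations_of_set_def)
    show "(\<lambda>xs. (take k xs, drop k xs)) \<in> {xs \<in> permutations_of_set V. set (take k xs) = B}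
      \<rightarrow> permutations_of_set B \<times> permutations_of_set (V - B)"
    proof (clarsimp simp: permutations_of_set_def)
      fix xs :: "'a list" assume "distinct xs" "V = set xs" "B = set (take k xs)"
      then show "set (drop k xs) = set xs - set (take k xs)"
        using set_take_disj_set_drop_if_distinct[of xs k k] append_take_drop_id[of k xs]
        by (metis Diff_cancel Diff_triv Int_commute Un_Diff Un_empty_left order_refl set_append)
    qed
  qed (use B length_finite_permutations_of_set[of _ B] in auto)
  then show ?thesis
    using assms B by (simp flip: bij_betw_same_card add: card_cartesian_product card_Diff_subset)
qed

text \<open>Rotation permutes the orderings, so every starting position contributes as much as
  position 0, where a \<open>k\<close>-set is the initial segment of
  \<open>fact k * fact (n - k)\<close> orderings.\<close>

lemma sum_over_cyclic_orders:
  fixes f :: "'a set \<Rightarrow> real"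
  assumes V: "finite V" "card V = n" and k: "0 < k" "k \<le> n"
  shows "(\<Sum>xs\<in>permutations_of_set V. \<Sum>i = 0..<int n. f (arc xs k i))
    = real n * fact k * fact (n - k) * (\<Sum>B\<in>nsets V k. f B)"
proof -
  let ?P = "permutations_of_set V"
  have len: "length xs = n" "xs \<noteq> []" if "xs \<in> ?P" for xs
    using length_finite_permutations_of_set[OF that] V k by auto
  have rot: "bij_betw (rotate i) ?P ?P" for i
  proof -
    have "inj_on (rotate i) ?P"
      using inj_fn[OF inj_rotate1, of i] by (auto simp: rotate_def intro: inj_on_subset)
    moreover have "rotate i ` ?P \<subseteq> ?P" by (auto simp: permutations_of_set_def)
    ultimately show ?thesis
      by (simp add: bij_betw_def endo_inj_surj)
  qed
  have "(\<Sum>xs\<in>?P. \<Sum>i = 0..<int n. f (arc xs k i)) = (\<Sum>xs\<in>?P. \<Sum>i<n. f (set (take k (rotate i xs))))"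
  proof (rule sum.cong[OF refl])
    fix xs assume "xs \<in> ?P"
    then show "(\<Sum>i = 0..<int n. f (arc xs k i)) = (\<Sum>i<n. f (set (take k (rotate i xs))))"
      using len[of xs] k
      by (intro sum.reindex_bij_witness[of _ int nat]) (auto simp flip: arc_of_nat)
  qed
  also have "\<dots> = (\<Sum>i<n. \<Sum>xs\<in>?P. f (set (take k (rotate i xs))))"
    by (rule sum.swap)
  also have "\<dots> = (\<Sum>i<n. \<Sum>xs\<in>?P. f (set (take k xs)))"
    by (intro sum.cong refl sum.reindex_bij_betw[OF rot])
  also have "(\<Sum>xs\<in>?P. f (set (take k xs)))
      = (\<Sum>B\<in>nsets V k. \<Sum>xs\<in>{xs \<in> ?P. set (take k xs) = B}. f (set (take k xs)))"
  proof (rule sum.group[symmetric])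
    show "(\<lambda>xs. set (take k xs)) ` ?P \<subseteq> nsets V k"
    proof clarify
      fix xs assume xs: "xs \<in> ?P"
      then have "distinct (take k xs)" "set (take k xs) \<subseteq> V"
        using set_take_subset[of k xs] by (auto simp: permutations_of_set_def)
      then show "set (take k xs) \<in> nsets V k"
        using len(1)[OF xs] k by (simp add: nsets_def distinct_card)
    qed
  qed (use V in \<open>simp_all add: finite_imp_finite_nsets\<close>)
  also have "\<dots> = (\<Sum>B\<in>nsets V k. fact k * fact (n - k) * f B)"
    using card_permutations_prefix[OF V(1), of _ k] V by (intro sum.cong refl) simp
  finally show ?thesis by (simp add: sum_distrib_left mult.assoc)
qed

section \<open>Disjoint pairs: Katona's cycle method\<close>

text \<open>\<open>A\<close> stands for \<open>F - Fs\<close> in the case \<open>d = 2\<close>: a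
  disjoint pair inside \<open>F\<close> is a 2-cluster, so neither of its members is in
  \<open>F - Fs\<close>.\<close>

locale katona_family =
  fixes V :: "'a set" and n k :: nat and F A :: "'a set set"
  assumes fin: "finite V" and card_V: "card V = n"
    and k_pos: "0 < k" and k_le: "2 * k \<le> n"
    and F_sub: "F \<subseteq> nsets V k" and A_sub: "A \<subseteq> F"
    and meet: "X \<in> A \<Longrightarrow> Y \<in> F \<Longrightarrow> X \<inter> Y \<noteq> {}"
begin

text \<open>Chosen so that the total weight of all \<open>k\<close>-sets is the left-hand side of
  the bound.\<close>

definition weight :: "'a set \<Rightarrow> real" where
  "weight X = (if X \<in> A then real n / real k else if X \<in> F then 1 else 0)"

lemma two_le_ratio: "2 \<le> real n / real k"
proof -
  have "2 * real k \<le> real n" using k_le by linarith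
  then show ?thesis using k_pos by (simp add: le_divide_eq)
qed

lemma two_less_ratio: "2 * k < n \<Longrightarrow> 2 < real n / real k"
proof -
  assume "2 * k < n"
  then have "2 * real k < real n" by linarith
  then show ?thesis using k_pos by (simp add: less_divide_eq)
qed

text \<open>If one set is in \<open>A\<close>, the other is outside \<open>F\<close> and weighs 0;
  otherwise both weigh at most 1, and \<open>2 \<le> n / k\<close>.\<close>

lemma weight_disjoint_le: "X \<inter> Y = {} \<Longrightarrow> weight X + weight Y \<le> real n / real k"
  using meet[of X Y] meet[of Y X] A_sub two_le_ratio by (auto simp: weight_def)

text \<open>Now 1 + 1 is strictly below \<open>n / k\<close>, so only a set of \<open>A\<close>
  paired with a set of weight 0 attains the bound.\<close>

lemma weight_disjoint_eq:
  assumes "X \<inter> Y = {}" "2 * k < n" "weight X + weight Y = real n / real k"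
  shows "(X \<in> A \<and> Y \<notin> F) \<or> (Y \<in> A \<and> X \<notin> F)"
  using meet[of X Y] meet[of Y X] A_sub two_less_ratio assms by (auto simp: weight_def split: if_splits)

lemma permutationD:
  assumes "xs \<in> permutations_of_set V"
  shows "length xs = n" "distinct xs" "xs \<noteq> []" "set xs = V"
  using assms length_finite_permutations_of_set[OF assms] card_V k_pos k_le
  by (auto simp: permutations_of_set_def)

lemma arc_disjointI:
  assumes "xs \<in> permutations_of_set V" "i + int k \<le> j" "j + int k \<le> i + int n"
  shows "arc xs k i \<inter> arc xs k j = {}"
  using arc_disjoint[of xs i k j] permutationD[OF assms(1)] assms by simp

text \<open>The arcs at distance at least \<open>k\<close> are disjoint from a member of
  \<open>A\<close>, so they are outside \<open>F\<close> and weigh 0.\<close>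

lemma sum_arc_weight:
  assumes xs: "xs \<in> permutations_of_set V" and a: "arc xs k a \<in> A"
  shows "(\<Sum>i = 0..<int n. weight (arc xs k i))
    = real n / real k + (\<Sum>i = a + 1..<a + int k. weight (arc xs k i) + weight (arc xs k (i - int k)))"
proof -
  have "weight (arc xs k i) = 0" if "a + int k \<le> i" "i \<le> a + int n - int k" for i
    using arc_disjointI[OF xs, of a i] that meet[OF a, of "arc xs k i"] A_sub
    by (auto simp: weight_def)
  then show ?thesis
    using sum_arc_unfold[of xs n k a weight] permutationD[OF xs] k_pos k_le a
    by (simp add: weight_def)
qed

lemma arc_pair_le:
  assumes "xs \<in> permutations_of_set V"
  shows "weight (arc xs k i) + weight (arc xs k (i - int k)) \<le> real n / real k"
  using weight_disjoint_le[of "arc xs k (i - int k)" "arc xs k i"]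
    arc_disjointI[OF assms, of "i - int k" i] k_le by simp

text \<open>With an arc in \<open>A\<close>, that arc and the \<open>k - 1\<close> pairs around it
  give at most \<open>k\<close> times \<open>n / k\<close>. Without one, each of the
  \<open>n\<close> arcs weighs at most 1.\<close>

lemma cyclic_bound:
  assumes xs: "xs \<in> permutations_of_set V"
  shows "(\<Sum>i = 0..<int n. weight (arc xs k i)) \<le> real n"
proof (cases "\<exists>a. arc xs k a \<in> A")
  case True
  then obtain a where a: "arc xs k a \<in> A" by blast
  have "(\<Sum>i = a + 1..<a + int k. weight (arc xs k i) + weight (arc xs k (i - int k)))
      \<le> (\<Sum>i = a + 1..<a + int k. real n / real k)"
    by (intro sum_mono arc_pair_le xs)
  also have "\<dots> = (real k - 1) * (real n / real k)"
    using k_pos by simp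
  finally have "(\<Sum>i = 0..<int n. weight (arc xs k i)) \<le> real k * (real n / real k)"
    unfolding sum_arc_weight[OF xs a] by (simp only: left_diff_distrib mult_1)
  then show ?thesis using k_pos by simp
next
  case False
  then have "(\<Sum>i = 0..<int n. weight (arc xs k i)) \<le> (\<Sum>i = 0..<int n. 1)"
    by (intro sum_mono) (auto simp: weight_def)
  then show ?thesis by simp
qed

text \<open>The arc at \<open>a\<close> takes \<open>n / k\<close> of the total \<open>n\<close>,
  which leaves exactly the sum of the upper bounds of the \<open>k - 1\<close> pairs.\<close>

lemma arc_pair_eq:
  assumes xs: "xs \<in> permutations_of_set V" and a: "arc xs k a \<in> A"
    and tight: "(\<Sum>i = 0..<int n. weight (arc xs k i)) = real n"
    and i: "a < i" "i < a + int k"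
  shows "weight (arc xs k i) + weight (arc xs k (i - int k)) = real n / real k"
proof -
  have "(\<Sum>i = a + 1..<a + int k. weight (arc xs k i) + weight (arc xs k (i - int k)))
      = real n - real n / real k"
    using sum_arc_weight[OF xs a] tight by simp
  also have "\<dots> = (\<Sum>i = a + 1..<a + int k. real n / real k)"
    using k_pos by (simp add: field_simps)
  finally show ?thesis
    by (rule sum_mono_inv) (use i arc_pair_le[OF xs] in auto)
qed

lemma sum_weight:
  "(\<Sum>B\<in>nsets V k. weight B) = real (card (F - A)) + real n / real k * real (card A)"
proof -
  have finF: "finite F" using F_sub finite_imp_finite_nsets[OF fin] finite_subset by blast
  have finA: "finite A" using finF A_sub finite_subset by blast
  have "(\<Sum>B\<in>nsets V k. weight B) = (\<Sum>B\<in>F. weight B)"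
    using F_sub A_sub finite_imp_finite_nsets[OF fin]
    by (intro sum.mono_neutral_right) (auto simp: weight_def)
  also have "\<dots> = (\<Sum>B\<in>F - A. weight B) + (\<Sum>B\<in>A. weight B)"
    using finF A_sub by (simp add: sum.subset_diff)
  also have "(\<Sum>B\<in>A. weight B) = (\<Sum>B\<in>A. real n / real k)"
    by (intro sum.cong) (auto simp: weight_def)
  also have "(\<Sum>B\<in>F - A. weight B) = (\<Sum>B\<in>F - A. 1)"
    by (intro sum.cong) (auto simp: weight_def)
  finally show ?thesis by simp
qed

lemma double_count:
  "(\<Sum>xs\<in>permutations_of_set V. \<Sum>i = 0..<int n. weight (arc xs k i))
    = real n * fact k * fact (n - k) * (real (card (F - A)) + real n / real k * real (card A))"
  using sum_over_cyclic_orders[OF fin card_V k_pos, of weight] k_le by (simp add: sum_weight)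

lemma sum_permutations_const:
  "(\<Sum>xs\<in>permutations_of_set V. real n) = real n * fact k * fact (n - k) * real (n choose k)"
proof -
  have "fact k * fact (n - k) * real (n choose k) = fact n"
    using binomial_fact_lemma[of k n] k_le
    by (metis (mono_tags, lifting) add_leE mult_2 of_nat_fact of_nat_mult)
  then show ?thesis using fin card_V by simp
qed

theorem katona_bound: "real (card (F - A)) + real n / real k * real (card A) \<le> real (n choose k)"
proof -
  have "(\<Sum>xs\<in>permutations_of_set V. \<Sum>i = 0..<int n. weight (arc xs k i))
      \<le> (\<Sum>xs\<in>permutations_of_set V. real n)"
    by (intro sum_mono cyclic_bound)
  then show ?thesis
    unfolding double_count sum_permutations_const using k_pos k_le by simp
qed

section \<open>Equality for disjoint pairs\<close>

context
  assumes eq: "real (card (F - A)) + real n / real k * real (card A) = real (n choose k)"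
begin

text \<open>The average over all orderings equals the upper bound for each cyclic sum, so no cyclic
  sum falls short of it.\<close>

lemma cyclic_tight:
  assumes "xs \<in> permutations_of_set V"
  shows "(\<Sum>i = 0..<int n. weight (arc xs k i)) = real n"
  using double_count[unfolded eq, folded sum_permutations_const]
  by (rule sum_mono_inv) (use assms cyclic_bound in auto)

lemma all_if_no_pure:
  assumes "A = {}"
  shows "F = nsets V k"
proof (rule card_subset_eq[OF finite_imp_finite_nsets[OF fin] F_sub])
  show "card F = card (nsets V k)"
    using eq assms by (simp add: card_nsets fin card_V)
qed

context
  assumes less: "2 * k < n"
begin

lemma arc_pair_cases:
  assumes "xs \<in> permutations_of_set V" "arc xs k a \<in> A" "a < i" "i < a + int k"
  shows "(arc xs k i \<in> A \<and> arc xs k (i - int k) \<notin> F) \<or> (arc xs k (i - int k) \<in> A \<and> arc xs k i \<notin> F)"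
  using weight_disjoint_eq[of "arc xs k i" "arc xs k (i - int k)", OF _ less arc_pair_eq[OF assms(1,2) cyclic_tight[OF assms(1)] assms(3,4)]]
    arc_disjointI[OF assms(1), of "i - int k" i] k_le
  by (auto simp: Int_commute)

lemma permutation_exists: "\<exists>xs. set xs = X \<and> distinct xs" if "X \<subseteq> V"
  using that fin finite_distinct_list finite_subset by metis

text \<open>Any \<open>B \<in> A\<close> and \<open>C \<in> F\<close> intersect, so some ordering
  has them as overlapping arcs: \<open>B\<close> is \<open>l1 @ l2\<close> and \<open>C\<close> is
  \<open>l2 @ l3\<close>. Then \<open>C\<close> belongs to one of the tight pairs around
  \<open>B\<close>, and a member of \<open>F\<close> in such a pair is in \<open>A\<close>.\<close>

lemma all_pure:
  assumes "A \<noteq> {}"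
  shows "F = A"
proof -
  obtain B where B: "B \<in> A" using assms by blast
  have "C \<in> A" if C: "C \<in> F" for C
  proof -
    have BV: "B \<subseteq> V" "card B = k" "finite B" and CV: "C \<subseteq> V" "card C = k" "finite C"
      using B C A_sub F_sub by (auto simp: nsets_def)
    obtain l1 where l1: "set l1 = B - C" "distinct l1" using permutation_exists[of "B - C"] BV by blast
    obtain l2 where l2: "set l2 = B \<inter> C" "distinct l2" using permutation_exists[of "B \<inter> C"] BV by blast
    obtain l3 where l3: "set l3 = C - B" "distinct l3" using permutation_exists[of "C - B"] CV by blast
    obtain l4 where l4: "set l4 = V - (B \<union> C)" "distinct l4" using permutation_exists[of "V - (B \<union> C)"] by blast
    let ?xs = "l1 @ l2 @ l3 @ l4"
    have xs: "?xs \<in> permutations_of_set V"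
      using l1 l2 l3 l4 BV CV by (auto simp: permutations_of_set_def)
    have setB: "set (l1 @ l2) = B" and setC: "set (l2 @ l3) = C" using l1 l2 l3 by auto
    have "distinct (l1 @ l2)" "distinct (l2 @ l3)" using xs by (auto simp: permutations_of_set_def)
    then have len: "length (l1 @ l2) = k" "length (l2 @ l3) = k"
      using distinct_card[of "l1 @ l2"] distinct_card[of "l2 @ l3"] by (simp_all only: setB setC BV CV)
    have arcB: "arc ?xs k 0 = B"
      using arc_append[of ?xs "[]" "l1 @ l2" "l3 @ l4" k] len setB k_pos by simp
    have arcC: "arc ?xs k (int (length l1)) = C"
      using arc_append[of ?xs l1 "l2 @ l3" l4 k] len setC k_pos by simp
    have "B \<inter> C \<noteq> {}" using meet B C by blast
    then have "l2 \<noteq> []" using l2 by auto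
    then have "0 < length l2" by simp
    then have "length l1 < k" using len(1) unfolding length_append by linarith
    show "C \<in> A"
    proof (cases "l1 = []")
      case True
      then show ?thesis using arcB arcC B by simp
    next
      case False
      then show ?thesis
        using arc_pair_cases[OF xs, of 0 "int (length l1)"] arcB arcC B C \<open>length l1 < k\<close> by auto
    qed
  qed
  then show ?thesis using A_sub by blast
qed

section \<open>Pure families: finding the center of the star\<close>

context
  assumes pure: "F = A"
begin

lemma arc_pair_iff:
  assumes "xs \<in> permutations_of_set V" "arc xs k a \<in> F" "a < i" "i < a + int k"
  shows "arc xs k i \<in> F \<longleftrightarrow> arc xs k (i - int k) \<notin> F"
  using arc_pair_cases[OF assms(1) _ assms(3,4)] assms(2) pure by auto

text \<open>Take the last start \<open>b\<close> in \<open>{a..<a + int k}\<close> whose arc is in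
  \<open>F\<close>. The next arc is not in \<open>F\<close>, so its partner, starting at
  \<open>b + 1 - int k\<close>, is; at the end of the range this partner is the arc at
  \<open>a\<close> itself. The two arcs found overlap in the single position
  \<open>b\<close>.\<close>

lemma arc_ends:
  assumes xs: "xs \<in> permutations_of_set V" and a: "arc xs k a \<in> F"
  shows "\<exists>b. arc xs k b \<in> F \<and> arc xs k (b - int k + 1) \<in> F"
proof -
  let ?I = "{b \<in> {a..<a + int k}. arc xs k b \<in> F}"
  have fin_I: "finite ?I" by (rule finite_subset[of _ "{a..<a + int k}"]) auto
  define b where "b = Max ?I"
  have "a \<in> ?I" using a k_pos by auto
  then have "b \<in> ?I" unfolding b_def using Max_in[OF fin_I] by blast
  then have b: "arc xs k b \<in> F" "a \<le> b" "b < a + int k" by auto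
  have max: "c \<le> b" if "c \<in> ?I" for c
    unfolding b_def using Max_ge[OF fin_I that] .
  show ?thesis
  proof (cases "b + 1 < a + int k")
    case True
    then have "arc xs k (b + 1) \<notin> F" using max[of "b + 1"] b by auto
    then have "arc xs k (b + 1 - int k) \<in> F"
      using arc_pair_iff[OF xs a, of "b + 1"] True b by auto
    then show ?thesis using b(1) by (auto simp: algebra_simps)
  next
    case False
    then have "b - int k + 1 = a" using b by auto
    then show ?thesis using a b by auto
  qed
qed

text \<open>No arc starting in the \<open>k - 1\<close> positions after \<open>b\<close> is in
  \<open>F\<close>, so their partners, starting \<open>k\<close> earlier, all are. The exclusion
  moves forward: if the arc at \<open>j\<close> is out, its partner at \<open>j - int k\<close> is
  in and is disjoint from the arc at \<open>j + 1\<close>.\<close>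

lemma arc_between:
  assumes xs: "xs \<in> permutations_of_set V"
    and b: "arc xs k b \<in> F" "arc xs k (b - int k + 1) \<in> F" and i: "b - int k < i" "i \<le> b"
  shows "arc xs k i \<in> F"
proof -
  have outside: "arc xs k j \<notin> F" if "b + 1 \<le> j" "j < b + int k" for j
    using that
  proof (induction j rule: int_ge_induct)
    case base
    have "arc xs k (b - int k + 1) \<inter> arc xs k (b + 1) = {}"
      using arc_disjointI[OF xs, of "b - int k + 1" "b + 1"] k_le by simp
    then show ?case using meet b pure by blast
  next
    case (step j)
    then have "arc xs k (j - int k) \<in> F" using arc_pair_iff[OF xs b(1), of j] by auto
    \<comment> \<open>These two windows span \<open>2 * k + 1\<close> positions, which fit into one
      period because \<open>2 * k < n\<close>.\<close>
    moreover have "arc xs k (j - int k) \<inter> arc xs k (j + 1) = {}"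
      using arc_disjointI[OF xs, of "j - int k" "j + 1"] less by simp
    ultimately show ?case using meet pure by blast
  qed
  show ?thesis
  proof (cases "i = b")
    case False
    then show ?thesis
      using outside[of "i + int k"] arc_pair_iff[OF xs b(1), of "i + int k"] i by auto
  qed (use b in simp)
qed

text \<open>Order \<open>V\<close> so that \<open>L\<close> is \<open>l1 @ l2 @ [x]\<close>,
  \<open>R\<close> is \<open>[x] @ l3 @ l4\<close> and \<open>S\<close> is
  \<open>l2 @ [x] @ l3\<close>. Then \<open>S\<close> is an arc starting between \<open>L\<close>
  and \<open>R\<close>, and \<open>arc_between\<close> applies.\<close>

lemma center_fill:
  assumes LR: "L \<in> F" "R \<in> F" "L \<inter> R = {x}"
    and S: "x \<in> S" "S \<subseteq> L \<union> R" "card S = k"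
  shows "S \<in> F"
proof -
  have L: "L \<subseteq> V" "card L = k" "finite L" and R: "R \<subseteq> V" "card R = k" "finite R"
    using LR F_sub by (auto simp: nsets_def)
  have x: "x \<in> L" "x \<in> R" using LR by auto
  obtain l1 where l1: "set l1 = L - S" "distinct l1" using permutation_exists[of "L - S"] L by blast
  obtain l2 where l2: "set l2 = L \<inter> S - {x}" "distinct l2"
    using permutation_exists[of "L \<inter> S - {x}"] L by blast
  obtain l3 where l3: "set l3 = R \<inter> S - {x}" "distinct l3"
    using permutation_exists[of "R \<inter> S - {x}"] R by blast
  obtain l4 where l4: "set l4 = R - S" "distinct l4" using permutation_exists[of "R - S"] R by blast
  obtain l5 where l5: "set l5 = V - (L \<union> R)" "distinct l5"
    using permutation_exists[of "V - (L \<union> R)"] by blast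
  let ?xs = "l1 @ l2 @ [x] @ l3 @ l4 @ l5"
  have disj: "L \<inter> R \<subseteq> {x}" using LR by simp
  have xs: "?xs \<in> permutations_of_set V"
    unfolding permutations_of_set_def mem_Collect_eq
  proof
    have "set ?xs = (L - S) \<union> (L \<inter> S - {x}) \<union> {x} \<union> (R \<inter> S - {x}) \<union> (R - S) \<union> (V - (L \<union> R))"
      by (simp add: l1 l2 l3 l4 l5 Un_assoc)
    then show "set ?xs = V" using L(1) R(1) x by blast
    show "distinct ?xs"
      by (simp add: l1 l2 l3 l4 l5) (use disj x S in blast)
  qed
  have setL: "set (l1 @ l2 @ [x]) = L" using x by (auto simp: l1 l2)
  have setR: "set ([x] @ l3 @ l4) = R" using x by (auto simp: l3 l4)
  have setS: "set (l2 @ [x] @ l3) = S" using S by (auto simp: l2 l3)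
  have "distinct (l1 @ l2 @ [x])" "distinct ([x] @ l3 @ l4)" "distinct (l2 @ [x] @ l3)"
    using xs by (auto simp: permutations_of_set_def)
  then have len: "length (l1 @ l2 @ [x]) = k" "length ([x] @ l3 @ l4) = k" "length (l2 @ [x] @ l3) = k"
    using distinct_card[of "l1 @ l2 @ [x]"] distinct_card[of "[x] @ l3 @ l4"] distinct_card[of "l2 @ [x] @ l3"]
    by (simp_all only: setL setR setS L R S)
  have arcL: "arc ?xs k 0 = L"
    using arc_append[of ?xs "[]" "l1 @ l2 @ [x]" "l3 @ l4 @ l5" k] len(1) setL k_pos by simp
  have arcR: "arc ?xs k (int (length (l1 @ l2))) = R"
    using arc_append[of ?xs "l1 @ l2" "[x] @ l3 @ l4" l5 k] len(2) setR k_pos by simp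
  have arcS: "arc ?xs k (int (length l1)) = S"
    using arc_append[of ?xs l1 "l2 @ [x] @ l3" "l4 @ l5" k] len(3) setS k_pos by simp
  have "int (length (l1 @ l2)) - int k + 1 = 0" using len(1) by auto
  then show ?thesis
    using arc_between[OF xs, of "int (length (l1 @ l2))" "int (length l1)"] arcL arcR arcS LR len(1)
    by auto
qed

text \<open>If \<open>E\<close> leaves \<open>L \<union> R\<close>, it contains at most
  \<open>k - 1\<close> of the \<open>2 * k - 2\<close> points of \<open>?W\<close>. The remaining
  ones suffice to form, together with \<open>x\<close>, a set that is in \<open>F\<close> by
  \<open>center_fill\<close> but disjoint from \<open>E\<close>.\<close>

lemma avoids_center:
  assumes LR: "L \<in> F" "R \<in> F" "L \<inter> R = {x}" and E: "E \<in> F" "x \<notin> E"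
  shows "E \<subseteq> L \<union> R"
proof (rule ccontr)
  assume nsub: "\<not> E \<subseteq> L \<union> R"
  have L: "card L = k" "finite L" and R: "card R = k" "finite R" and E': "card E = k" "finite E"
    using LR E F_sub by (auto simp: nsets_def)
  let ?W = "L \<union> R - {x}"
  have "card (L \<union> R) = 2 * k - 1" using card_Un_Int[of L R] L R LR by simp
  then have W: "card ?W = 2 * k - 2" using LR by (subst card_Diff_singleton) auto
  have "card (?W \<inter> E) < card E" using nsub E E' by (intro psubset_card_mono) auto
  then have "k - 1 \<le> card (?W - E)"
    using W E' L R card_Diff_subset_Int[of ?W E] by simp
  then obtain T where T: "T \<subseteq> ?W - E" "card T = k - 1" "finite T"
    by (meson obtain_subset_with_card_n)
  then have "insert x T \<in> F"
    using LR k_pos by (intro center_fill[OF LR]) (auto simp: card_insert_if)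
  then show False using meet[of E "insert x T"] E T pure by auto
qed

text \<open>Equality fixes \<open>card F\<close> as the size of a full star, so it suffices that all
  members contain the common point \<open>x\<close> of \<open>L\<close> and \<open>R\<close>. A
  member missing \<open>x\<close> would confine \<open>F\<close> to the \<open>2 * k - 1\<close>
  points of \<open>L \<union> R\<close>, too few for that size.\<close>

theorem full_star_if_pure:
  assumes k2: "2 \<le> k"
  shows "\<exists>x\<in>V. F = {B \<in> nsets V k. x \<in> B}"
proof -
  have cardF: "card F = (n - 1) choose (k - 1)"
  proof -
    have "real n * real (card F) = real k * real (n choose k)"
      using eq pure k_pos by (simp add: field_simps)
    also have "\<dots> = real n * real ((n - 1) choose (k - 1))"
      using times_binomial_minus1_eq[OF k_pos, of n] by (metis of_nat_mult)
    finally show ?thesis using less by simp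
  qed
  have n1: "k - 1 \<le> n - 1" using k_le by simp
  have "F \<noteq> {}" using cardF zero_less_binomial[OF n1] by auto
  then obtain B where B: "B \<in> F" by blast
  then have BV: "B \<subseteq> V" "card B = k" "finite B" using F_sub by (auto simp: nsets_def)
  obtain l1 where l1: "set l1 = B" "distinct l1" using permutation_exists[of B] BV by blast
  obtain l2 where l2: "set l2 = V - B" "distinct l2" using permutation_exists[of "V - B"] by blast
  let ?xs = "l1 @ l2"
  have xs: "?xs \<in> permutations_of_set V"
    using l1 l2 BV by (auto simp: permutations_of_set_def)
  have "length l1 = k" using l1 BV distinct_card by metis
  then have "arc ?xs k 0 \<in> F"
    using arc_append[of ?xs "[]" l1 l2 k] l1 B k_pos by simp
  then obtain b where b: "arc ?xs k b \<in> F" "arc ?xs k (b - int k + 1) \<in> F"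
    using arc_ends[OF xs] by blast
  define x where "x = cyc ?xs b"
  define L where "L = arc ?xs k (b - int k + 1)"
  define R where "R = arc ?xs k b"
  have "{b..<b - int k + 1 + int k} = {b}" by auto
  then have "L \<inter> R = {x}"
    using arc_Int[of ?xs "b - int k + 1" b k] permutationD[OF xs] k_le k_pos
    by (simp add: L_def R_def x_def)
  with b have LR: "L \<in> F" "R \<in> F" "L \<inter> R = {x}" by (simp_all add: L_def R_def)
  let ?W = "L \<union> R"
  have LRV: "L \<subseteq> V" "card L = k" "finite L" "R \<subseteq> V" "card R = k" "finite R" 
    using LR F_sub by (auto simp: nsets_def)
  then have cardW: "card ?W = 2 * k - 1" using card_Un_Int[of L R] LR by simp
  have "x \<in> E" if E: "E \<in> F" for E
  proof (rule ccontr)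
    assume xE: "x \<notin> E"
    have EV: "card E = k" "finite E" using E F_sub by (auto simp: nsets_def)
    have EW: "E \<subseteq> ?W" using avoids_center[OF LR E xE] .
    \<comment> \<open>Every point of \<open>E\<close> is also the common point of two members of \<open>F\<close> covering \<open>?W\<close>.\<close>
    have avoid: "D \<subseteq> ?W" if e: "e \<in> E" and D: "D \<in> F" "e \<notin> D" for e D
    proof -
      let ?R = "insert e (?W - E)"
      have "card (?W - E) = k - 1"
        using cardW EW EV by (simp add: card_Diff_subset)
      then have "card ?R = k" using e k_pos LRV by simp
      then have "?R \<in> F" using xE LR EW e by (intro center_fill[OF LR]) auto
      moreover have "E \<inter> ?R = {e}" "E \<union> ?R = ?W" using e EW by auto
      ultimately show ?thesis using avoids_center[OF E, of ?R e D] D by simp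
    qed
    have "F \<subseteq> nsets ?W k"
    proof
      fix D assume D: "D \<in> F"
      then have DV: "card D = k" "finite D" using F_sub by (auto simp: nsets_def)
      have "D \<subseteq> ?W"
      proof (rule ccontr)
        assume "\<not> D \<subseteq> ?W"
        \<comment> \<open>A member not inside \<open>?W\<close> must contain \<open>x\<close> and
          every point of \<open>E\<close>, which is \<open>k + 1\<close> points.\<close>
        then have "insert x E \<subseteq> D" using avoid avoids_center[OF LR D] D by blast
        then have "card (insert x E) \<le> k" using DV card_mono by metis
        then show False using xE EV by simp
      qed
      then show "D \<in> nsets ?W k" using DV by (simp add: nsets_def)
    qed
    then have "card F \<le> (2 * k - 1) choose k"
      using card_mono[of "nsets ?W k" F] card_nsets[of ?W k] cardW LRV
      by (simp add: finite_imp_finite_nsets)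
    also have "\<dots> = (2 * k - 1) choose (k - 1)"
      using binomial_symmetric[of k "2 * k - 1"] k_pos by (simp add: algebra_simps mult_2)
    also have "\<dots> < (2 * k) choose (k - 1)"
    proof -
      have "(2 * k) choose (k - 1) = ((2 * k - 1) choose (k - 2)) + ((2 * k - 1) choose (k - 1))"
        using choose_reduce_nat[of "2 * k" "k - 1"] k2 by (simp add: numeral_2_eq_2)
      moreover have "(2 * k - 1) choose (k - 2) > 0" using k2 by simp
      ultimately show ?thesis by simp
    qed
    also have "\<dots> \<le> (n - 1) choose (k - 1)"
      using less by (intro binomial_right_mono) auto
    finally show False using cardF by simp
  qed
  then have sub: "F \<subseteq> {B \<in> nsets V k. x \<in> B}" using F_sub by blast
  have xV: "x \<in> V" using LR LRV by blast
  have "card {B \<in> nsets V k. x \<in> B} = (n - 1) choose (k - 1)"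
    using bij_betw_same_card[OF bij_betw_insert_nsets[OF xV k_pos]] fin xV card_V
    by (simp add: card_nsets)
  then have "F = {B \<in> nsets V k. x \<in> B}"
    using sub cardF fin by (intro card_subset_eq) (simp_all add: finite_imp_finite_nsets)
  with xV show ?thesis by blast
qed

end
end
end
end

section \<open>Links and larger clusters\<close>

text \<open>Stated over any ground set, because the induction passes to
  \<open>V - {x}\<close>.\<close>

definition cluster :: "'a set \<Rightarrow> nat \<Rightarrow> nat \<Rightarrow> 'a set set \<Rightarrow> bool" where
  "cluster V k d C \<longleftrightarrow> C \<subseteq> nsets V k \<and> card C = d \<and> card (\<Union>C) \<le> 2 * k \<and> \<Inter>C = {}"

definition star :: "'a set \<Rightarrow> nat \<Rightarrow> 'a \<Rightarrow> 'a set set" where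
  "star V k x = {B \<in> nsets V k. x \<in> B}"

definition optimal :: "'a set \<Rightarrow> nat \<Rightarrow> 'a set set \<Rightarrow> 'a set set \<Rightarrow> bool" where
  "optimal V k F Fs \<longleftrightarrow>
     (Fs = {} \<and> (\<exists>x\<in>V. F = star V k x)) \<or> (F = Fs \<and> Fs = nsets V k)"

definition wsize :: "'a set \<Rightarrow> nat \<Rightarrow> 'a set set \<Rightarrow> 'a set set \<Rightarrow> real" where
  "wsize V k F Fs = real (card Fs) + real (card V) / real k * real (card (F - Fs))"

locale cluster_closed =
  fixes V :: "'a set" and k d :: nat and F Fs :: "'a set set"
  assumes fin: "finite V" and k_le: "2 * k \<le> card V"
    and Fs_sub: "Fs \<subseteq> F" and F_sub: "F \<subseteq> nsets V k"
    and closed: "cluster V k d C \<Longrightarrow> C \<subseteq> F \<Longrightarrow> C \<subseteq> Fs"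

text \<open>Two disjoint \<open>k\<close>-sets always form a 2-cluster, so \<open>F - Fs\<close> can
  serve as \<open>A\<close>. In the equality case an empty \<open>A\<close> gives the full family,
  and a nonempty \<open>A\<close> gives \<open>F = A\<close> and hence a star.\<close>

lemma pair_clusters_bound:
  assumes "cluster_closed V k 2 F Fs" "2 \<le> k"
  shows "wsize V k F Fs \<le> real (card V choose k)
    \<and> (card V \<noteq> 2 * k \<longrightarrow> wsize V k F Fs = real (card V choose k) \<longrightarrow> optimal V k F Fs)"
proof -
  interpret cluster_closed V k 2 F Fs by fact
  have Fs_eq: "F - (F - Fs) = Fs" using Fs_sub by blast
  interpret katona_family V "card V" k F "F - Fs"
  proof
    fix X Y assume X: "X \<in> F - Fs" and Y: "Y \<in> F"
    show "X \<inter> Y \<noteq> {}"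
    proof
      assume disj: "X \<inter> Y = {}"
      have XV: "X \<in> nsets V k" "card X = k" and YV: "Y \<in> nsets V k" "card Y = k"
        using X Y F_sub by (auto simp: nsets_def)
      have "X \<noteq> {}" using XV assms(2) by auto
      then have "X \<noteq> Y" using disj by auto
      moreover have "card (X \<union> Y) \<le> 2 * k" using card_Un_le[of X Y] XV YV by simp
      ultimately have "cluster V k 2 {X, Y}"
        using XV YV disj by (simp add: cluster_def)
      then show False using closed[of "{X, Y}"] X Y by auto
    qed
  qed (use assms(2) fin k_le F_sub in auto)
  have bound: "wsize V k F Fs \<le> real (card V choose k)"
    using katona_bound by (simp add: wsize_def Fs_eq)
  moreover have "optimal V k F Fs" if ne: "card V \<noteq> 2 * k" and "wsize V k F Fs = real (card V choose k)"
  proof -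
    have eq: "real (card (F - (F - Fs))) + real (card V) / real k * real (card (F - Fs)) = real (card V choose k)"
      using that by (simp add: wsize_def Fs_eq)
    have less: "2 * k < card V" using ne k_le by simp
    show ?thesis
    proof (cases "F - Fs = {}")
      case True
      then show ?thesis using all_if_no_pure[OF eq] Fs_sub by (auto simp: optimal_def)
    next
      case False
      have pure: "F = F - Fs" using all_pure[OF eq less False] .
      then have "Fs = {}" using Fs_sub by blast
      then show ?thesis
        using full_star_if_pure[OF eq less pure assms(2)] by (auto simp: optimal_def star_def)
    qed
  qed
  ultimately show ?thesis by blast
qed

section \<open>The induction step: links and multiplicities\<close>

locale link_step = cluster_closed V k "Suc d" F Fs
  for V :: "'a set" and k d :: nat and F Fs :: "'a set set" +
  assumes d2: "2 \<le> d" and dk: "Suc d \<le> k"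
    and IH_bound: "\<And>x L Ls. x \<in> V \<Longrightarrow> cluster_closed (V - {x}) (k - 1) d L Ls
      \<Longrightarrow> wsize (V - {x}) (k - 1) L Ls \<le> real ((card V - 1) choose (k - 1))"
    and IH_eq: "\<And>x L Ls. x \<in> V \<Longrightarrow> cluster_closed (V - {x}) (k - 1) d L Ls
      \<Longrightarrow> wsize (V - {x}) (k - 1) L Ls = real ((card V - 1) choose (k - 1))
      \<Longrightarrow> optimal (V - {x}) (k - 1) L Ls"
begin

definition link :: "'a \<Rightarrow> 'a set set" where
  "link x = {B \<in> nsets (V - {x}) (k - 1). insert x B \<in> F}"

text \<open>Adjoining the members of all \<open>d\<close>-clusters makes the closure condition of
  \<open>cluster_closed\<close> hold by construction, so the induction hypothesis applies to every
  link.\<close>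

definition link_core :: "'a \<Rightarrow> 'a set set" where
  "link_core x = {B \<in> link x. insert x B \<in> Fs \<or>
     (\<exists>C. cluster (V - {x}) (k - 1) d C \<and> C \<subseteq> link x \<and> B \<in> C)}"

text \<open>Summed over \<open>F - Fs\<close>, this is the number \<open>M\<close> of the
  overview.\<close>

definition mult :: "'a set \<Rightarrow> nat" where
  "mult B = card {x \<in> V. x \<in> B \<and> B - {x} \<in> link_core x}"

lemma k3: "3 \<le> k"
  using d2 dk by simp

lemma memberD: "B \<in> F \<Longrightarrow> B \<subseteq> V" "B \<in> F \<Longrightarrow> finite B" "B \<in> F \<Longrightarrow> card B = k"
  using F_sub by (auto simp: nsets_def)

lemma fin_F: "finite F"
  using F_sub finite_imp_finite_nsets[OF fin] finite_subset by blast

lemma link_iff: "x \<in> B \<Longrightarrow> B - {x} \<in> link x \<longleftrightarrow> B \<in> F"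
  using memberD[of B] by (auto simp: link_def nsets_def insert_absorb)

lemma link_closed:
  assumes "x \<in> V"
  shows "cluster_closed (V - {x}) (k - 1) d (link x) (link_core x)"
proof
  show "2 * (k - 1) \<le> card (V - {x})" using assms fin k_le by simp
qed (use fin in \<open>auto simp: link_def link_core_def\<close>)

text \<open>Lift a \<open>d\<close>-cluster containing \<open>B - {x}\<close> by \<open>x\<close>
  and add the exchanged set \<open>?D\<close>. Since \<open>?D\<close> misses \<open>x\<close>, it
  differs from all lifted sets and removes their only common point; the union gains only
  \<open>x\<close> and \<open>y\<close>, which the increase from \<open>2 * (k - 1)\<close> to
  \<open>2 * k\<close> allows.\<close>

lemma exchange_not_in_F:
  assumes B: "B \<in> F - Fs" "x \<in> B" "B - {x} \<in> link_core x" and y: "y \<in> V" "y \<notin> B"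
  shows "insert y (B - {x}) \<notin> F"
proof
  let ?D = "insert y (B - {x})"
  assume D: "?D \<in> F"
  have ins: "insert x (B - {x}) = B" using B by auto
  then obtain C where C: "cluster (V - {x}) (k - 1) d C" "C \<subseteq> link x" "B - {x} \<in> C"
    using B by (auto simp: link_core_def)
  have Cx: "x \<notin> c" if "c \<in> C" for c using C(2) that by (auto simp: link_def nsets_def)
  have fin_UC: "finite (\<Union>C)" and fin_C: "finite C"
  proof -
    have "\<Union>C \<subseteq> V" using C(2) by (auto simp: link_def nsets_def)
    then show "finite (\<Union>C)" using fin finite_subset by blast
    then show "finite C" by (rule finite_UnionD)
  qed
  let ?C = "insert ?D (insert x ` C)"
  have "inj_on (insert x) C" by (rule inj_onI) (simp add: insert_ident Cx)
  moreover have "?D \<notin> insert x ` C" using B y by auto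
  ultimately have "card ?C = Suc d"
    using C(1) fin_C by (simp add: card_image cluster_def)
  moreover have CF: "?C \<subseteq> F" using C(2) D by (auto simp: link_def)
  moreover have "card (\<Union>?C) \<le> 2 * k"
  proof -
    have small: "card (\<Union>C) \<le> 2 * (k - 1)" using C(1) by (simp add: cluster_def)
    have "\<Union>?C \<subseteq> insert y (insert x (\<Union>C))" using C(3) by auto
    then have "card (\<Union>?C) \<le> card (insert y (insert x (\<Union>C)))"
      using fin_UC by (intro card_mono) auto
    also have "\<dots> \<le> card (\<Union>C) + 2" using fin_UC by (auto simp: card_insert_if)
    also have "\<dots> \<le> 2 * k" using small k3 by linarith
    finally show ?thesis .
  qed
  moreover have "\<Inter>?C = {}"
  proof -
    have sub: "z \<in> \<Inter>C" if "z \<in> \<Inter>?C" for z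
    proof -
      have "z \<noteq> x" using that B y by auto
      then show ?thesis using that by auto
    qed
    have "\<Inter>C = {}" using C(1) by (simp add: cluster_def)
    with sub show ?thesis by (simp only: set_eq_iff empty_iff) blast
  qed
  ultimately have "cluster V k (Suc d) ?C"
    using subset_trans[OF CF F_sub] unfolding cluster_def by blast
  then have "?C \<subseteq> Fs" using closed CF by blast
  moreover have "B \<in> ?C" using C(3) ins by (metis imageI insertCI)
  ultimately show False using B by blast
qed

text \<open>Exchanging a point counted by \<open>mult B\<close> for a new point \<open>y\<close> yields a non-member of \<open>F\<close>, and \<open>B\<close>
  can be recovered from this non-member and \<open>y\<close>.\<close>

lemma mult_bound:
  "(card V - k) * (\<Sum>B\<in>F - Fs. mult B) + k * card F \<le> k * (card V choose k)"
proof -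
  let ?M = "nsets V k - F"
  let ?X = "\<lambda>B. {x \<in> V. x \<in> B \<and> B - {x} \<in> link_core x}"
  let ?P = "SIGMA B:F - Fs. ?X B \<times> (V - B)"
  let ?f = "\<lambda>(B, x, y). (insert y (B - {x}), y)"
  have fin_M: "finite ?M" using finite_imp_finite_nsets[OF fin] by simp
  have f_in: "?f ` ?P \<subseteq> (SIGMA D:?M. D)"
  proof clarsimp
    fix B x y assume B: "B \<in> F" "B \<notin> Fs" "x \<in> B" "B - {x} \<in> link_core x" and y: "y \<in> V" "y \<notin> B"
    then show "insert y (B - {x}) \<in> nsets V k \<and> insert y (B - {x}) \<notin> F"
      using exchange_not_in_F[of B x y] memberD[of B] k3 by (auto simp: nsets_def)
  qed
  have "inj_on ?f ?P"
  proof (rule inj_onI)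
    fix p q assume p: "p \<in> ?P" and q: "q \<in> ?P" and eq: "?f p = ?f q"
    obtain B x y where p': "p = (B, x, y)" by (cases p) auto
    obtain B' x' y' where q': "q = (B', x', y')" by (cases q) auto
    have y: "y' = y" and ins: "insert y (B - {x}) = insert y (B' - {x'})"
      using eq by (auto simp: p' q')
    have B: "B \<in> F - Fs" "x \<in> B" "B - {x} \<in> link_core x" "y \<notin> B"
      and B': "B' \<in> F - Fs" "x' \<in> B'" "x' \<in> V" "y \<notin> B'"
      using p q by (auto simp: p' q' y)
    have rest: "B - {x} = B' - {x'}"
      using ins B B' by (metis Diff_iff Diff_insert_absorb)
    have B'_eq: "B' = insert x' (B - {x})" unfolding rest using B' by auto
    \<comment> \<open>Otherwise \<open>x'\<close> is outside \<open>B\<close>, and \<open>B'\<close>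
      is itself an exchange of \<open>B\<close> at \<open>x\<close>, hence not in
      \<open>F\<close>.\<close>
    have "x' = x"
    proof (rule ccontr)
      assume "x' \<noteq> x"
      moreover have "x' \<notin> B - {x}" unfolding rest by simp
      ultimately have "x' \<notin> B" by blast
      then show False using exchange_not_in_F[OF B(1-3) B'(3)] B'_eq B' by simp
    qed
    then show "p = q" using B'_eq B y by (auto simp: p' q')
  qed
  then have "card ?P \<le> card (SIGMA D:?M. D)"
    using f_in fin_M fin by (intro card_inj_on_le[of ?f]) (auto simp: nsets_def intro!: finite_SigmaI)
  also have "card (SIGMA D:?M. D) = k * card ?M"
    using fin_M by (subst card_SigmaI) (auto simp: nsets_def)
  also have "card ?P = (\<Sum>B\<in>F - Fs. mult B * (card V - k))"
    using fin_F fin memberD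
    by (subst card_SigmaI) (auto simp: mult_def card_cartesian_product card_Diff_subset intro!: sum.cong)
  also have "card ?M = (card V choose k) - card F"
    using F_sub fin_F fin by (simp add: card_Diff_subset card_nsets)
  finally have "(card V - k) * (\<Sum>B\<in>F - Fs. mult B) \<le> k * (card V choose k) - k * card F"
    by (simp add: sum_distrib_left mult.commute diff_mult_distrib2)
  moreover have "card F \<le> card V choose k"
    using card_mono[OF finite_imp_finite_nsets[OF fin] F_sub] fin by (simp add: card_nsets)
  then have "k * card F \<le> k * (card V choose k)" by simp
  ultimately show ?thesis by linarith
qed

lemma mult_closed: "B \<in> Fs \<Longrightarrow> mult B = k"
proof -
  assume B: "B \<in> Fs"
  then have BF: "B \<in> F" using Fs_sub by blast
  then have "{x \<in> V. x \<in> B \<and> B - {x} \<in> link_core x} = B"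
    using B memberD[of B] link_iff[of _ B] by (auto simp: link_core_def insert_absorb)
  then show ?thesis using memberD[OF BF] by (simp add: mult_def)
qed

lemma mult_complement:
  assumes "B \<in> F"
  shows "card {x \<in> V. x \<in> B \<and> B - {x} \<notin> link_core x} + mult B = k"
proof -
  have "{x \<in> V. x \<in> B \<and> B - {x} \<notin> link_core x} \<union> {x \<in> V. x \<in> B \<and> B - {x} \<in> link_core x} = B"
    using memberD[OF assms] by auto
  then have "card ({x \<in> V. x \<in> B \<and> B - {x} \<notin> link_core x} \<union> {x \<in> V. x \<in> B \<and> B - {x} \<in> link_core x}) = k"
    using memberD[OF assms] by simp
  then show ?thesis
    using fin by (subst (asm) card_Un_disjoint) (auto simp: mult_def)
qed

lemma card_link_part:
  "card {B \<in> link x. P B} = card {B \<in> F. x \<in> B \<and> P (B - {x})}"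
proof (rule bij_betw_same_card[of "insert x"])
  show "bij_betw (insert x) {B \<in> link x. P B} {B \<in> F. x \<in> B \<and> P (B - {x})}"
  proof (rule bij_betwI[where g = "\<lambda>B. B - {x}"])
    have "insert x B - {x} = B" if "B \<in> link x" for B
      using that by (auto simp: link_def nsets_def)
    then show "insert x \<in> {B \<in> link x. P B} \<rightarrow> {B \<in> F. x \<in> B \<and> P (B - {x})}"
      by (simp add: link_def)
    show "(\<lambda>B. B - {x}) \<in> {B \<in> F. x \<in> B \<and> P (B - {x})} \<rightarrow> {B \<in> link x. P B}"
      using link_iff by auto
  qed (auto simp: link_def nsets_def)
qed

lemma sum_card_link_core: "(\<Sum>x\<in>V. card (link_core x)) = (\<Sum>B\<in>F. mult B)"
proof -
  have "card (link_core x) = card {B \<in> F. x \<in> B \<and> B - {x} \<in> link_core x}" for x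
  proof -
    have "link_core x = {B \<in> link x. B \<in> link_core x}" by (auto simp: link_core_def)
    then show ?thesis using card_link_part[of x "\<lambda>B. B \<in> link_core x"] by simp
  qed
  then show ?thesis
    using sum_multicount_gen[of V F "\<lambda>x B. x \<in> B \<and> B - {x} \<in> link_core x" mult] fin fin_F
    by (simp add: mult_def)
qed

lemma sum_card_link_diff: "(\<Sum>x\<in>V. card (link x - link_core x)) + (\<Sum>B\<in>F. mult B) = k * card F"
proof -
  have "card (link x - link_core x) = card {B \<in> F. x \<in> B \<and> B - {x} \<notin> link_core x}" for x
    using card_link_part[of x "\<lambda>B. B \<notin> link_core x"] by (simp add: set_diff_eq)
  then have "(\<Sum>x\<in>V. card (link x - link_core x)) = (\<Sum>B\<in>F. card {x \<in> V. x \<in> B \<and> B - {x} \<notin> link_core x})"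
    using sum_multicount_gen[of V F "\<lambda>x B. x \<in> B \<and> B - {x} \<notin> link_core x"
        "\<lambda>B. card {x \<in> V. x \<in> B \<and> B - {x} \<notin> link_core x}"] fin fin_F by simp
  then show ?thesis
    using mult_complement by (simp flip: sum.distrib)
qed

lemma k_times_binomial: "real k * real (card V choose k) = real (card V) * real ((card V - 1) choose (k - 1))"
  using times_binomial_minus1_eq[of k "card V"] k3 by (metis of_nat_mult gr0I not_numeral_le_zero)

text \<open>Counting pairs of a point and a member containing it, the cores have total size
  \<open>M + k * card Fs\<close> and the links \<open>k * card F\<close>, which leaves
  \<open>k * card (F - Fs) - M\<close> outside the cores. The factor \<open>k - 1\<close> clears the
  denominator of the link weight.\<close>

lemma sum_wsize_link_core:
  "(real k - 1) * (\<Sum>x\<in>V. wsize (V - {x}) (k - 1) (link x) (link_core x))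
    = (real k - 1) * (real k * card Fs + real (\<Sum>B\<in>F - Fs. mult B))
      + (real (card V) - 1) * (real k * card (F - Fs) - real (\<Sum>B\<in>F - Fs. mult B))"
proof -
  let ?M = "\<Sum>B\<in>F - Fs. mult B"
  have "(\<Sum>B\<in>F. mult B) = ?M + (\<Sum>B\<in>Fs. mult B)"
    using fin_F Fs_sub by (simp add: sum.subset_diff)
  then have total: "(\<Sum>B\<in>F. mult B) = ?M + k * card Fs"
    using mult_closed by simp
  have "card F = card (F - Fs) + card Fs"
    using fin_F Fs_sub by (metis card_Diff_subset card_mono finite_subset le_add_diff_inverse2)
  then have "(\<Sum>x\<in>V. card (link x - link_core x)) + ?M = k * card (F - Fs)"
    using sum_card_link_diff total by (simp add: algebra_simps)
  then have diff: "real (\<Sum>x\<in>V. card (link x - link_core x)) = real k * real (card (F - Fs)) - real ?M"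
    by (simp add: eq_diff_eq flip: of_nat_add of_nat_mult of_nat_sum)
  have V1: "real (card (V - {x})) = real (card V) - 1" if "x \<in> V" for x
    using that fin card_gt_0_iff[of V] by (auto simp: of_nat_diff)
  have "wsize (V - {x}) (k - 1) (link x) (link_core x)
      = real (card (link_core x)) + (real (card V) - 1) / (real k - 1) * real (card (link x - link_core x))"
    if "x \<in> V" for x
    using V1[OF that] k3 by (simp add: wsize_def of_nat_diff)
  then have "(\<Sum>x\<in>V. wsize (V - {x}) (k - 1) (link x) (link_core x))
      = real (\<Sum>x\<in>V. card (link_core x)) + (real (card V) - 1) / (real k - 1) * real (\<Sum>x\<in>V. card (link x - link_core x))"
    by (simp add: sum.distrib sum_distrib_left)
  also have "\<dots> = (real ?M + real k * card Fs) + (real (card V) - 1) / (real k - 1) * (real k * card (F - Fs) - real ?M)"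
    unfolding diff sum_card_link_core total by simp
  finally show ?thesis using k3 by (simp add: field_simps)
qed

text \<open>The bounds from the links and \<open>mult_bound\<close> are added in the one proportion that
  cancels the unknown total multiplicity.\<close>

lemma wsize_decomposition:
  "(real k)\<^sup>2 * (real (card V choose k) - wsize V k F Fs)
    = (real k - 1) * (\<Sum>x\<in>V. real ((card V - 1) choose (k - 1)) - wsize (V - {x}) (k - 1) (link x) (link_core x))
      + (real k * real (card V choose k)
          - (real ((card V - k) * (\<Sum>B\<in>F - Fs. mult B)) + real k * real (card F)))"
proof -
  let ?M = "real (\<Sum>B\<in>F - Fs. mult B)" and ?c = "real (card V choose k)" and ?n = "real (card V)"
    and ?S = "\<Sum>x\<in>V. wsize (V - {x}) (k - 1) (link x) (link_core x)"
  have cardF: "real (card F) = real (card (F - Fs)) + real (card Fs)"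
    using fin_F Fs_sub by (metis card_Diff_subset card_mono finite_subset le_add_diff_inverse2 of_nat_add)
  have "real (card V - k) = ?n - real k" using k_le by simp
  then have nk: "real ((card V - k) * (\<Sum>B\<in>F - Fs. mult B)) = (?n - real k) * ?M" by simp
  have "(\<Sum>x\<in>V. real ((card V - 1) choose (k - 1)) - wsize (V - {x}) (k - 1) (link x) (link_core x))
      = real k * ?c - ?S"
    unfolding sum_subtractf k_times_binomial by simp
  then have "(real k - 1) * (\<Sum>x\<in>V. real ((card V - 1) choose (k - 1)) - wsize (V - {x}) (k - 1) (link x) (link_core x))
      = (real k - 1) * (real k * ?c) - (real k - 1) * ?S"
    by (simp only: right_diff_distrib)
  moreover have "(real k)\<^sup>2 * wsize V k F Fs = (real k)\<^sup>2 * real (card Fs) + real k * ?n * real (card (F - Fs))"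
    using k3 by (simp add: wsize_def field_simps power2_eq_square)
  \<comment> \<open>In \<open>(k - 1) * ?S\<close> the coefficient of \<open>?M\<close> is
    \<open>(k - 1) - (?n - 1)\<close>, the negative of its coefficient \<open>?n - k\<close> in the
    other bound.\<close>
  ultimately show ?thesis
    unfolding sum_wsize_link_core nk cardF by (simp add: algebra_simps power2_eq_square)
qed

lemma mult_slack: "0 \<le> real k * real (card V choose k)
    - (real ((card V - k) * (\<Sum>B\<in>F - Fs. mult B)) + real k * real (card F))"
  using mult_bound by (simp flip: of_nat_mult of_nat_add)

lemma link_slack: "x \<in> V \<Longrightarrow>
    0 \<le> real ((card V - 1) choose (k - 1)) - wsize (V - {x}) (k - 1) (link x) (link_core x)"
  using IH_bound[OF _ link_closed] by simp

theorem step_bound: "wsize V k F Fs \<le> real (card V choose k)"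
proof -
  have "0 \<le> (real k)\<^sup>2 * (real (card V choose k) - wsize V k F Fs)"
    unfolding wsize_decomposition
  proof (rule add_nonneg_nonneg[OF mult_nonneg_nonneg mult_slack])
    show "0 \<le> real k - 1" using k3 by simp
  qed (rule sum_nonneg, rule link_slack)
  then show ?thesis using k3 by (simp add: zero_le_mult_iff)
qed

section \<open>Equality in the induction step\<close>

context
  assumes eq: "wsize V k F Fs = real (card V choose k)"
begin

text \<open>With zero on the left of \<open>wsize_decomposition\<close>, both nonnegative parts on
  the right vanish, and so does the slack of each single link.\<close>

lemma link_optimal:
  assumes "x \<in> V"
  shows "optimal (V - {x}) (k - 1) (link x) (link_core x)"
proof -
  let ?s = "\<lambda>x. real ((card V - 1) choose (k - 1)) - wsize (V - {x}) (k - 1) (link x) (link_core x)"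
  have k1: "real k - 1 > 0" using k3 by simp
  have "sum ?s V \<ge> 0" using link_slack by (rule sum_nonneg)
  then have "(real k - 1) * sum ?s V \<ge> 0" using k1 by (intro mult_nonneg_nonneg) auto
  then have "(real k - 1) * sum ?s V = 0"
    using add_nonneg_eq_0_iff[OF _ mult_slack]
      wsize_decomposition[unfolded eq diff_self mult_zero_right, symmetric] by blast
  from mult_eq_0_iff[THEN iffD1, OF this] have "sum ?s V = 0" using k1 by auto
  then have "?s x = 0"
    using sum_nonneg_eq_0_iff[of V ?s] fin link_slack assms by blast
  then show ?thesis using IH_eq[OF assms link_closed[OF assms]] by simp
qed

text \<open>Full links force \<open>F\<close> to be everything. Members outside \<open>Fs\<close>
  then weigh \<open>n / k > 1\<close> each, so any such member would push the weighted size above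
  the total.\<close>

lemma all_links_full:
  assumes "\<And>x. x \<in> V \<Longrightarrow> link x = nsets (V - {x}) (k - 1)"
  shows "F = Fs \<and> Fs = nsets V k"
proof -
  have "nsets V k \<subseteq> F"
  proof
    fix B assume B: "B \<in> nsets V k"
    then obtain x where x: "x \<in> B" using k3 by (fastforce simp: nsets_def)
    then have "x \<in> V" "B - {x} \<in> nsets (V - {x}) (k - 1)" using B by (auto simp: nsets_def)
    then have "B - {x} \<in> link x" using assms by simp
    then show "B \<in> F" using link_iff x by blast
  qed
  then have F: "F = nsets V k" using F_sub by blast
  then have "card Fs + card (F - Fs) = card V choose k"
    using fin_F Fs_sub fin by (metis card_Diff_subset card_mono card_nsets finite_subset le_add_diff_inverse)
  then have "real (card Fs) + real (card (F - Fs)) = real (card V choose k)"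
    by (metis of_nat_add)
  then have "(real (card V) / real k - 1) * real (card (F - Fs)) = 0"
    using eq by (simp add: wsize_def algebra_simps)
  moreover have "real (card V) / real k - 1 \<noteq> 0" using k_le k3 by (auto simp: field_simps)
  ultimately have "card (F - Fs) = 0" by (simp only: mult_eq_0_iff of_nat_eq_0_iff) blast
  then have "F - Fs = {}" using fin_F by (simp only: card_0_eq finite_Diff)
  then show ?thesis using F Fs_sub by blast
qed

text \<open>The link of \<open>x\<close> decides membership for all sets through \<open>x\<close>.
  This is enough to see that the link of any other \<open>z \<noteq> y\<close> is neither full nor a
  star with a center other than \<open>y\<close>, and every \<open>k\<close>-set contains such a
  \<open>z\<close>.\<close>

lemma one_link_star:
  assumes x: "x \<in> V" and y: "y \<in> V" "y \<noteq> x"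
    and link_x: "link_core x = {}" "link x = star (V - {x}) (k - 1) y"
  shows "Fs = {} \<and> F = star V k y"
proof -
  have Fx: "B \<in> F \<longleftrightarrow> y \<in> B" if "B \<in> nsets V k" "x \<in> B" for B
    using that link_iff[of x B] link_x y by (auto simp: star_def nsets_def)
  have pick: "\<exists>T. T \<subseteq> V - X \<and> card T = m \<and> finite T" if "X \<subseteq> V" "card X + m \<le> card V" for X m
  proof -
    have "m \<le> card (V - X)" using that fin finite_subset[OF that(1) fin] by (simp add: card_Diff_subset)
    then show ?thesis by (meson obtain_subset_with_card_n)
  qed
  have other: "link_core z = {} \<and> link z = star (V - {z}) (k - 1) y" if z: "z \<in> V" "z \<noteq> y" for z
  proof (cases "z = x")
    case False
    have "card {x, y, z} + (k - 2) \<le> card V" using k3 k_le y z False by simp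
    moreover have "{x, y, z} \<subseteq> V" using x y z by simp
    ultimately obtain T where T: "T \<subseteq> V - {x, y, z}" "card T = k - 2" "finite T"
      using pick[of "{x, y, z}" "k - 2"] by blast
    \<comment> \<open>This set contains \<open>x\<close> and \<open>z\<close> but avoids
      \<open>y\<close>, so it is not in \<open>F\<close> and the link of \<open>z\<close> is not
      full. A star at \<open>x\<close> is excluded too, as it would contain
      \<open>insert x T\<close>.\<close>
    let ?B = "insert x (insert z T)"
    have "z \<notin> T" "x \<notin> insert z T" using T False by auto
    then have "card ?B = k" using T(2,3) k3 by simp
    then have "?B \<in> nsets V k" using T x z by (auto simp: nsets_def)
    then have "?B \<notin> F" using Fx[of ?B] T(1) y z by blast
    moreover have "?B - {z} = insert x T" using T(1) False by blast
    ultimately have Tz: "insert x T \<notin> link z" using link_iff[of z ?B] by simp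
    have "card (insert x T) = k - 1" using T k3 by (subst card_insert_disjoint) auto
    then have Tn: "insert x T \<in> nsets (V - {z}) (k - 1)"
      using T x False by (auto simp: nsets_def)
    have "link z \<noteq> nsets (V - {z}) (k - 1)" using Tz Tn by auto
    then obtain c where c: "link_core z = {}" "c \<in> V - {z}" "link z = star (V - {z}) (k - 1) c"
      using link_optimal[OF z(1)] by (auto simp: optimal_def)
    have "c \<noteq> x" using Tz Tn c by (auto simp: star_def)
    have "c = y"
    proof (rule ccontr)
      assume "c \<noteq> y"
      have "card {x, y, z, c} \<le> 4" by (simp add: card_insert_if)
      then have "card {x, y, z, c} + (k - 3) \<le> card V" using k3 k_le by linarith
      moreover have "{x, y, z, c} \<subseteq> V" using x y z c by simp
      ultimately obtain U where U: "U \<subseteq> V - {x, y, z, c}" "card U = k - 3" "finite U"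
        using pick[of "{x, y, z, c}" "k - 3"] by blast
      \<comment> \<open>Containing both \<open>x\<close> and \<open>y\<close>, this set is in
        \<open>F\<close>; as it avoids \<open>c\<close>, the link of \<open>z\<close> cannot be a
        star at \<open>c\<close>.\<close>
      let ?D = "insert x (insert y (insert z U))"
      have "z \<notin> U" "y \<notin> insert z U" "x \<notin> insert y (insert z U)" using U False y z by auto
      then have "card ?D = k" using U(2,3) k3 by simp
      then have "?D \<in> nsets V k" using U x y z by (auto simp: nsets_def)
      then have "?D \<in> F" using Fx[of ?D] by simp
      then have "?D - {z} \<in> link z" using link_iff[of z ?D] by simp
      then have "c \<in> ?D" using c by (auto simp: star_def)
      then show False using U(1) c(2) \<open>c \<noteq> x\<close> \<open>c \<noteq> y\<close> by blast
    qed
    then show ?thesis using c by simp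
  qed (use link_x in simp)
  have point: "\<exists>z\<in>V. z \<in> B \<and> z \<noteq> y" if "B \<in> nsets V k" for B
  proof -
    have "\<not> B \<subseteq> {y}" using that k3 card_mono[of "{y}" B] by (auto simp: nsets_def)
    then show ?thesis using that by (auto simp: nsets_def)
  qed
  have "B \<in> F \<longleftrightarrow> y \<in> B" if B: "B \<in> nsets V k" for B
  proof -
    obtain z where z: "z \<in> V" "z \<in> B" "z \<noteq> y" using point[OF B] by blast
    then have "B \<in> F \<longleftrightarrow> B - {z} \<in> star (V - {z}) (k - 1) y"
      using link_iff[of z B] other[of z] by simp
    then show ?thesis using z B by (auto simp: star_def nsets_def)
  qed
  then have "F = star V k y" using F_sub by (auto simp: star_def)
  moreover have "B \<notin> Fs" for B
  proof
    assume B: "B \<in> Fs"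
    then have BF: "B \<in> F" using Fs_sub by blast
    then obtain z where z: "z \<in> V" "z \<in> B" "z \<noteq> y" using point F_sub by blast
    then have "B - {z} \<in> link_core z" using link_iff[of z B] B BF by (simp add: link_core_def insert_absorb)
    then show False using other[of z] z by simp
  qed
  ultimately show ?thesis by blast
qed

text \<open>A single link that is not full is a star with empty core, and
  \<open>one_link_star\<close> extends it to the whole family.\<close>

theorem step_eq: "optimal V k F Fs"
proof (cases "\<forall>x\<in>V. link x = nsets (V - {x}) (k - 1)")
  case True
  then show ?thesis using all_links_full by (auto simp: optimal_def)
next
  case False
  then obtain x where x: "x \<in> V" "link x \<noteq> nsets (V - {x}) (k - 1)" by blast
  then obtain y where "y \<in> V - {x}" "link_core x = {}" "link x = star (V - {x}) (k - 1) y"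
    using link_optimal[OF x(1)] by (auto simp: optimal_def)
  then show ?thesis using one_link_star[OF x(1), of y] by (auto simp: optimal_def)
qed

end
end

section \<open>The induction on \<open>d\<close> and the conclusion\<close>

theorem cluster_bound:
  assumes "2 \<le> d" "d \<le> k" "cluster_closed V k d F Fs"
  shows "wsize V k F Fs \<le> real (card V choose k)
    \<and> (\<not> (d = 2 \<and> card V = 2 * k) \<longrightarrow> wsize V k F Fs = real (card V choose k) \<longrightarrow> optimal V k F Fs)"
  using assms
\<comment> \<open>Passing to a link changes the ground set, lowers \<open>k\<close> and replaces
  both families, so all four are generalized.\<close>
proof (induction d arbitrary: V k F Fs rule: dec_induct)
  case base
  then show ?case using pair_clusters_bound[of V k F Fs] by auto
next
  case (step d)
  interpret cluster_closed V k "Suc d" F Fs by (rule step.prems)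
  have IH: "wsize (V - {x}) (k - 1) L Ls \<le> real ((card V - 1) choose (k - 1))
    \<and> (wsize (V - {x}) (k - 1) L Ls = real ((card V - 1) choose (k - 1)) \<longrightarrow> optimal (V - {x}) (k - 1) L Ls)"
    if "x \<in> V" "cluster_closed (V - {x}) (k - 1) d L Ls" for x L Ls
  proof -
    have V1: "card (V - {x}) = card V - 1" using that(1) fin by simp
    \<comment> \<open>A link is never in the exceptional case, even if \<open>V\<close> is.\<close>
    have "card V - 1 \<noteq> 2 * (k - 1)" using k_le step.prems step.hyps by linarith
    then show ?thesis
      using step.IH[OF _ that(2)] step.prems V1 by auto
  qed
  interpret link_step V k d F Fs
    by unfold_locales (use step IH in auto)
  show ?case using step_bound step_eq step.hyps by auto
qed

theorem theorem1:
  fixes n k d :: nat and F Fs :: "nat set set"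
  assumes "2 \<le> d" and "d \<le> k" and "real k \<le> real n / 2"
    and "Fs \<subseteq> F" and "F \<subseteq> nsets {1..n} k"
    and "\<And>C. is_cluster n k d C \<Longrightarrow> C \<subseteq> F \<Longrightarrow> C \<subseteq> Fs"
  shows "real (card Fs) + real n / real k * real (card (F - Fs)) \<le> real (n choose k)
    \<and> (\<not> (d = 2 \<and> n = 2 * k) \<longrightarrow>
         real (card Fs) + real n / real k * real (card (F - Fs)) = real (n choose k) \<longrightarrow>
           (Fs = {} \<and> (\<exists>x \<in> {1..n}. F = max_star n k x))
           \<or> (F = Fs \<and> Fs = nsets {1..n} k))"
proof -
  have "cluster_closed {1..n} k d F Fs"
  proof
    show "2 * k \<le> card {1..n}" using assms(3) by simp
    show "C \<subseteq> Fs" if "cluster {1..n} k d C" "C \<subseteq> F" for C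
      using assms(6)[of C] that by (simp add: cluster_def is_cluster_def)
  qed (use assms in auto)
  from cluster_bound[OF assms(1,2) this] show ?thesis
    by (simp add: wsize_def optimal_def star_def max_star_def)
qed

end
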